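(* Let $n \ge 2$ and let $f \colon \mathbb{R}^n \to \mathbb{R}$ be a nonconstant polynomial. Suppose that: (i) $f|_{\mathbb{R}^J} \not\equiv 0$ for all nonempty $J \subseteq \{1,\ldots,n\}$; (ii) one of the following statements holds: (ii1) $f_{\Delta} > 0$ on $(\mathbb{R}\setminus\{0\})^n$ for all $\Delta \in \Gamma_{\infty}(f)$; (ii2) $f_{\Delta} < 0$ on $(\mathbb{R}\setminus\{0\})^n$ for all $\Delta \in \Gamma_{\infty}(f)$. Then $\mathcal{Z}(f)$ is compact.
   Context: $\mathcal{Z}(f) := \{x \in \mathbb{R}^n \mid f(x) = 0\}$ is the zero set of $f$. For $J \subseteq \{1,\ldots,n\}$, $\mathbb{R}^J := \{x \in \mathbb{R}^n \mid x_j = 0 \text{ for all } j \notin J\}$. Write $f = \sum_{\alpha} a_\alpha x^\alpha$ with $\alpha \in \mathbb{Z}_+^n$ (tuples of non-negative integers) and $x^\alpha = x_1^{\alpha_1}\cdots x_n^{\alpha_n}$. The Newton polyhedron $\Gamma(f)$ is the convex hull in $\mathbb{R}^n$ of $\{\alpha \mid a_\alpha \neq 0\}$ (the origin is not added). For nonzero $q \in \mathbb{R}^n$ let $d(q,\Gamma(f)) := \min\{\langle q,\alpha\rangle \mid \alpha \in \Gamma(f)\}$ and $\Delta(q,\Gamma(f)) := \{\alpha \in \Gamma(f) \mid \langle q,\alpha\rangle = d(q,\Gamma(f))\}$, which is a face of $\Gamma(f)$. The Newton boundary at infinity $\Gamma_\infty(f)$ consists of all faces $\Delta(q,\Gamma(f))$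 with $q \in \mathbb{R}^n$ and $\min_{j=1,\ldots,n} q_j < 0$; "$\Delta \in \Gamma_\infty(f)$" means that $\Delta$ is one of these faces. For a face $\Delta$ of $\Gamma(f)$, $f_\Delta := \sum_{\alpha \in \Delta} a_\alpha x^\alpha$. *)

theory Defs
  imports "HOL-Analysis.Analysis" "HOL-Library.Poly_Mapping"
begin

text \<open>
  A real polynomial in the variables indexed by \<open>'n\<close> is its finitely supported coefficient
  function \<open>\<alpha> \<mapsto> a\<^sub>\<alpha>\<close>, with exponents \<open>\<alpha>\<close> in \<open>nat ^ 'n\<close>.
\<close>
type_synonym 'n real_poly = "(nat ^ 'n) \<Rightarrow>\<^sub>0 real"

definition monom_eval :: "nat ^ 'n \<Rightarrow> real ^ 'n::finite \<Rightarrow> real" where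
  "monom_eval \<alpha> x = (\<Prod>j\<in>UNIV. (x $ j) ^ (\<alpha> $ j))"

definition poly_eval :: "'n real_poly \<Rightarrow> real ^ 'n::finite \<Rightarrow> real" where
  "poly_eval f x = (\<Sum>\<alpha>\<in>Poly_Mapping.keys f. Poly_Mapping.lookup f \<alpha> * monom_eval \<alpha> x)"

definition zero_set :: "'n real_poly \<Rightarrow> (real ^ 'n::finite) set" where
  "zero_set f = {x. poly_eval f x = 0}"

definition coord_subspace :: "'n set \<Rightarrow> (real ^ 'n::finite) set" where
  "coord_subspace J = {x. \<forall>j. j \<notin> J \<longrightarrow> x $ j = 0}"

definition exponent_vec :: "nat ^ 'n \<Rightarrow> real ^ 'n::finite" where
  "exponent_vec \<alpha> = (\<chi> j. real (\<alpha> $ j))"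

definition newton_polyhedron :: "'n real_poly \<Rightarrow> (real ^ 'n::finite) set" where
  "newton_polyhedron f = convex hull (exponent_vec ` Poly_Mapping.keys f)"

text \<open>
  The infimum in \<open>supp_value\<close> is a minimum whenever \<open>f \<noteq> 0\<close>; see \<open>supp_value_attained\<close>.
\<close>
definition supp_value :: "real ^ 'n::finite \<Rightarrow> (real ^ 'n) set \<Rightarrow> real" where
  "supp_value q P = (INF \<alpha>\<in>P. q \<bullet> \<alpha>)"

definition supp_face :: "real ^ 'n::finite \<Rightarrow> (real ^ 'n) set \<Rightarrow> (real ^ 'n) set" where
  "supp_face q P = {\<alpha> \<in> P. q \<bullet> \<alpha> = supp_value q P}"

definition newton_boundary_infinity :: "'n real_poly \<Rightarrow> (real ^ 'n::finite) set set" where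
  "newton_boundary_infinity f =
     {supp_face q (newton_polyhedron f) | q. Min (range (\<lambda>j. q $ j)) < 0}"

definition face_poly :: "'n real_poly \<Rightarrow> (real ^ 'n::finite) set \<Rightarrow> 'n real_poly" where
  "face_poly f \<Delta> =
     (\<Sum>\<alpha> | \<alpha> \<in> Poly_Mapping.keys f \<and> exponent_vec \<alpha> \<in> \<Delta>.
        Poly_Mapping.single \<alpha> (Poly_Mapping.lookup f \<alpha>))"

definition torus :: "(real ^ 'n::finite) set" where
  "torus = {x. \<forall>j. x $ j \<noteq> 0}"

lemma supp_value_attained:
  fixes f :: "'n::finite real_poly"
  assumes "f \<noteq> 0"
  shows "\<exists>\<alpha>\<in>newton_polyhedron f. q \<bullet> \<alpha> = supp_value q (newton_polyhedron f) \<and>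
           (\<forall>\<beta>\<in>newton_polyhedron f. q \<bullet> \<alpha> \<le> q \<bullet> \<beta>)"
proof -
  let ?P = "newton_polyhedron f"
  have "compact ?P"
    unfolding newton_polyhedron_def by (intro finite_imp_compact_convex_hull) simp
  moreover have "?P \<noteq> {}"
    using assms by (simp add: newton_polyhedron_def)
  ultimately obtain \<alpha> where \<alpha>: "\<alpha> \<in> ?P" "\<forall>\<beta>\<in>?P. q \<bullet> \<alpha> \<le> q \<bullet> \<beta>"
    using continuous_attains_inf[of ?P "\<lambda>\<alpha>. q \<bullet> \<alpha>"] continuous_on_inner[OF continuous_on_const continuous_on_id]
    by metis
  have "supp_value q ?P = q \<bullet> \<alpha>"
    unfolding supp_value_def by (rule cInf_eq_minimum) (use \<alpha> in auto)
  with \<alpha> show ?thesis by auto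
qed

end

theory Submission
  imports Defs
begin

text \<open>
  Put \<open>\<mu>(x) = (\<Sum>\<alpha>. \<bar>x^\<alpha>\<bar>)\<close>, summed over the exponents of \<open>f\<close>. If all \<open>f\<^sub>\<Delta>\<close> are positive on the
  torus, then \<open>f \<ge> c \<mu>\<close> for some \<open>c > 0\<close> at all points of large norm. By density it is enough to
  see this on the torus. A sequence \<open>x\<^sub>k\<close> violating it may be assumed to have constant signs and a
  constant largest monomial \<open>\<alpha>\<^sub>0\<close>. Write \<open>\<bar>x\<^sub>k\<^sub>j\<bar> = exp (- y\<^sub>k\<^sub>j)\<close>; after passing to a subsequence, each
  \<open>\<langle>y\<^sub>k, \<beta> - \<alpha>\<^sub>0\<rangle>\<close> is bounded or tends to infinity. Projecting \<open>y\<^sub>k\<close> orthogonally to the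
  differences \<open>\<beta> - \<alpha>\<^sub>0\<close> of the bounded kind changes it by a bounded \<open>b\<^sub>k\<close>, and for large \<open>k\<close> the
  vector \<open>q = y\<^sub>k - b\<^sub>k\<close> has a negative coordinate and is minimal exactly on the \<open>\<beta>\<close> of the bounded
  kind. So these span a face \<open>\<Delta>\<close> at infinity, and \<open>f(x\<^sub>k) / \<bar>x\<^sub>k^\<alpha>\<^sub>0\<bar>\<close> tends to a positive multiple of a
  value of \<open>f\<^sub>\<Delta>\<close> on the torus, a contradiction. Finally, a zero of \<open>f\<close> of large norm would kill
  all monomials of \<open>f\<close>, and hence \<open>f\<close> on the coordinate subspace of its support.
\<close>

section \<open>Subsequences and bounded orthogonal corrections\<close>

lemma finite_range_constant_subseq:
  fixes h :: "nat \<Rightarrow> 'a"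
  assumes "finite (range h)"
  obtains r :: "nat \<Rightarrow> nat" and v where "strict_mono r" "\<And>k. h (r k) = v"
proof -
  obtain i where "infinite {k. h k = h i}"
    using pigeonhole_infinite[OF infinite_UNIV_nat assms] by auto
  then obtain r :: "nat \<Rightarrow> nat" where "strict_mono r" "\<forall>k. r k \<in> {k. h k = h i}"
    using infinite_enumerate by blast
  then show thesis by (intro that[of r "h i"]) auto
qed

text \<open>Each element of \<open>W\<close> costs one more extraction: a subsequence of
  \<open>g w\<close> converges in the extended reals, and nonnegativity rules out the limit minus
  infinity. Both alternatives survive passing to subsequences, so those already secured are
  kept.\<close>

lemma nonneg_subseq_bounded_or_at_top:
  fixes g :: "'w \<Rightarrow> nat \<Rightarrow> real"
  assumes "finite W" "\<And>w k. w \<in> W \<Longrightarrow> 0 \<le> g w k"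
  shows "\<exists>r. strict_mono r \<and>
    (\<forall>w\<in>W. bounded (range (\<lambda>k. g w (r k))) \<or> filterlim (\<lambda>k. g w (r k)) at_top sequentially)"
  using assms
proof (induction W rule: finite_induct)
  case empty
  show ?case using strict_mono_id by auto
next
  case (insert w W)
  obtain r :: "nat \<Rightarrow> nat" where r: "strict_mono r"
    "\<And>w. w \<in> W \<Longrightarrow> bounded (range (\<lambda>k. g w (r k))) \<or> filterlim (\<lambda>k. g w (r k)) at_top sequentially"
    using insert by auto
  obtain l and s :: "nat \<Rightarrow> nat" where s: "strict_mono s" "((\<lambda>k. ereal (g w (r k))) \<circ> s) \<longlonglongrightarrow> l"
    using compact_complete_linorder by blast
  have lim: "(\<lambda>k. ereal (g w (r (s k)))) \<longlonglongrightarrow> l"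
    using s(2) by (simp add: o_def)
  have "bounded (range (\<lambda>k. g w (r (s k)))) \<or> filterlim (\<lambda>k. g w (r (s k))) at_top sequentially"
  proof (cases l)
    case (real a)
    then have "(\<lambda>k. g w (r (s k))) \<longlonglongrightarrow> a" using lim by simp
    then show ?thesis by (metis convergent_imp_bounded)
  next
    case PInf
    then show ?thesis using lim by (simp add: tendsto_PInfty_eq_at_top)
  next
    case MInf
    have "0 \<le> l"
      using lim by (rule LIMSEQ_le_const) (use insert.prems in \<open>auto simp: zero_ereal_def\<close>)
    with MInf show ?thesis by simp
  qed
  moreover have "bounded (range (\<lambda>k. g v (r (s k)))) \<or> filterlim (\<lambda>k. g v (r (s k))) at_top sequentially"
    if "v \<in> W" for v
  proof -
    have sub: "range (\<lambda>k. g v (r (s k))) \<subseteq> range (\<lambda>k. g v (r k))" by auto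
    from r(2)[OF that] show ?thesis
      by (elim disjE) (auto intro: bounded_subset[OF _ sub] filterlim_compose[OF _ filterlim_subseq[OF s(1)]])
  qed
  ultimately show ?case
    using strict_mono_compose[OF r(1) s(1)] by (intro exI[of _ "\<lambda>k. r (s k)"]) (auto simp: o_def)
qed

text \<open>Take \<open>b k\<close> to be the orthogonal projection of \<open>y k\<close> onto
  \<open>span U\<close>. Its coefficients in an orthonormal basis are inner products of
  \<open>y k\<close> with elements of the span, and these inherit boundedness from \<open>U\<close>
  by linearity.\<close>

lemma bounded_correction_orthogonal:
  fixes y :: "nat \<Rightarrow> 'a::euclidean_space"
  assumes "\<And>u. u \<in> U \<Longrightarrow> bounded (range (\<lambda>k. u \<bullet> y k))"
  obtains b where "bounded (range b)" "\<And>u k. u \<in> U \<Longrightarrow> u \<bullet> (y k - b k) = 0"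
proof -
  obtain B where B: "B \<subseteq> span U" "pairwise orthogonal B" "\<And>e. e \<in> B \<Longrightarrow> norm e = 1"
    "independent B" "span B = span U"
    using orthonormal_basis_subspace[of "span U"] subspace_span by metis
  have finB: "finite B" using B(4) independent_imp_finite by blast
  define b where "b k = (\<Sum>e\<in>B. (e \<bullet> y k) *\<^sub>R e)" for k
  have bdd: "bounded (range (\<lambda>k. u \<bullet> y k))" if "u \<in> span U" for u
    using that
  proof (induction rule: span_induct_alt)
    case base
    then show ?case by (simp add: image_constant_conv)
  next
    case (step c x v)
    show ?case
      using bounded_plus_comp[OF bounded_scaleR_comp[OF assms[OF step(1)], of c] step(2)]
      by (simp add: inner_add_left)
  qed
  have "\<exists>C. \<forall>e\<in>B. \<forall>k. \<bar>e \<bullet> y k\<bar> \<le> C e"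
    using bdd B(1) by (intro bchoice) (fastforce simp: bounded_iff)
  then obtain C where C: "\<And>e k. e \<in> B \<Longrightarrow> \<bar>e \<bullet> y k\<bar> \<le> C e" by auto
  have "norm (b k) \<le> (\<Sum>e\<in>B. C e)" for k
    unfolding b_def using C B(3) by (intro sum_norm_le) simp
  then have "bounded (range b)" by (auto simp: bounded_iff)
  moreover have "u \<bullet> (y k - b k) = 0" if "u \<in> U" for u k
  proof -
    have B_eq: "e \<bullet> b k = e \<bullet> y k" if "e \<in> B" for e
    proof -
      have "e \<bullet> b k = (\<Sum>e'\<in>B. if e' = e then e \<bullet> y k else 0)"
        unfolding b_def inner_sum_right
      proof (rule sum.cong[OF refl])
        fix e' assume "e' \<in> B"
        then show "e \<bullet> ((e' \<bullet> y k) *\<^sub>R e') = (if e' = e then e \<bullet> y k else 0)"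
          using B(2) B(3)[OF that] that by (auto simp: pairwise_def orthogonal_def norm_eq_1)
      qed
      then show ?thesis using that finB by simp
    qed
    have "u \<in> span B" using that B(5) span_base by blast
    then show ?thesis
      by (induction rule: span_induct_alt) (simp_all add: B_eq inner_add_left inner_diff_right)
  qed
  ultimately show thesis using that by blast
qed

section \<open>Face polynomials and monomials in logarithmic coordinates\<close>

lemma lookup_face_poly:
  "Poly_Mapping.lookup (face_poly f \<Delta>) \<alpha> =
    (if \<alpha> \<in> Poly_Mapping.keys f \<and> exponent_vec \<alpha> \<in> \<Delta> then Poly_Mapping.lookup f \<alpha> else 0)"
  unfolding face_poly_def lookup_sum lookup_single when_def by (subst sum.delta) auto

lemma poly_eval_face_poly:
  "poly_eval (face_poly f \<Delta>) x =
    (\<Sum>\<alpha> | \<alpha> \<in> Poly_Mapping.keys f \<and> exponent_vec \<alpha> \<in> \<Delta>. Poly_Mapping.lookup f \<alpha> * monom_eval \<alpha> x)"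
proof -
  have "Poly_Mapping.keys (face_poly f \<Delta>) = {\<alpha> \<in> Poly_Mapping.keys f. exponent_vec \<alpha> \<in> \<Delta>}"
    by (auto simp: lookup_face_poly in_keys_iff split: if_splits)
  then show ?thesis
    unfolding poly_eval_def by (intro sum.cong) (auto simp: lookup_face_poly)
qed

text \<open>A half-space containing all exponents contains their convex hull, so the minimum of
  \<open>q\<close> over the polyhedron is already attained at the exponent \<alpha>.\<close>

lemma exponent_vec_in_supp_face_iff:
  fixes q :: "real ^ 'n::finite"
  assumes "\<alpha> \<in> Poly_Mapping.keys f" "\<beta> \<in> Poly_Mapping.keys f"
    and min: "\<And>\<gamma>. \<gamma> \<in> Poly_Mapping.keys f \<Longrightarrow> q \<bullet> exponent_vec \<alpha> \<le> q \<bullet> exponent_vec \<gamma>"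
  shows "exponent_vec \<beta> \<in> supp_face q (newton_polyhedron f) \<longleftrightarrow>
    q \<bullet> exponent_vec \<beta> = q \<bullet> exponent_vec \<alpha>"
proof -
  let ?P = "newton_polyhedron f"
  have keys: "exponent_vec \<gamma> \<in> ?P" if "\<gamma> \<in> Poly_Mapping.keys f" for \<gamma>
    using that unfolding newton_polyhedron_def by (simp add: hull_inc)
  have "?P \<subseteq> {x. q \<bullet> exponent_vec \<alpha> \<le> q \<bullet> x}"
    unfolding newton_polyhedron_def
    by (rule hull_minimal) (use min convex_halfspace_ge in auto)
  then have "supp_value q ?P = q \<bullet> exponent_vec \<alpha>"
    unfolding supp_value_def using keys[OF assms(1)] by (intro cInf_eq_minimum) auto
  then show ?thesis using keys[OF assms(2)] by (simp add: supp_face_def)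
qed

text \<open>Once signs are split off, monomials become exponentials of linear forms in
  \<open>y\<close>: the smaller the inner product with \<open>y\<close>, the larger the
  monomial.\<close>

lemma monom_eval_signed_exp:
  fixes s y :: "real ^ 'n::finite"
  shows "monom_eval \<alpha> (\<chi> j. s $ j * exp (- (y $ j))) = monom_eval \<alpha> s * exp (- (exponent_vec \<alpha> \<bullet> y))"
proof -
  have "(\<Prod>j\<in>UNIV. exp (- (y $ j)) ^ (\<alpha> $ j)) = exp (- (exponent_vec \<alpha> \<bullet> y))"
    by (simp add: inner_vec_def exponent_vec_def exp_sum sum_negf[symmetric] exp_of_nat_mult[symmetric])
  then show ?thesis
    by (simp add: monom_eval_def power_mult_distrib prod.distrib)
qed

lemma continuous_on_monom_eval: "continuous_on S (monom_eval \<alpha>)"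
  unfolding monom_eval_def[abs_def] by (intro continuous_intros)

lemma continuous_on_poly_eval: "continuous_on S (poly_eval f)"
  unfolding poly_eval_def[abs_def]
  by (intro continuous_on_sum continuous_on_mult continuous_on_const continuous_on_monom_eval)

section \<open>Domination of the monomials on the torus\<close>

text \<open>The factor \<sigma> lets one argument serve both signs of the face polynomials. The
  restriction to the torus makes logarithms of all coordinates available.\<close>

lemma poly_dominates_monomials_on_torus:
  fixes f :: "'n::finite real_poly"
  assumes pos: "\<And>\<Delta> x. \<Delta> \<in> newton_boundary_infinity f \<Longrightarrow> x \<in> torus \<Longrightarrow> 0 < \<sigma> * poly_eval (face_poly f \<Delta>) x"
  shows "\<exists>c>0. \<exists>R. \<forall>x\<in>torus. R \<le> norm x \<longrightarrow>
    c * (\<Sum>\<alpha>\<in>Poly_Mapping.keys f. \<bar>monom_eval \<alpha> x\<bar>) \<le> \<sigma> * poly_eval f x"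
proof (rule ccontr)
  define K where "K = Poly_Mapping.keys f"
  define a where "a = Poly_Mapping.lookup f"
  define e :: "nat ^ 'n \<Rightarrow> real ^ 'n" where "e = exponent_vec"
  define \<mu> where "\<mu> x = (\<Sum>\<alpha>\<in>K. \<bar>monom_eval \<alpha> x\<bar>)" for x :: "real ^ 'n"
  have finK: "finite K" by (simp add: K_def)
  assume "\<not> ?thesis"
  then have "\<exists>x\<in>torus. R \<le> norm x \<and> \<sigma> * poly_eval f x < c * \<mu> x" if "c > 0" for c R
    using that by (auto simp: not_le \<mu>_def K_def)
  from this[of "1 / real (Suc k)" "real k" for k]
  have "\<forall>k. \<exists>x. x \<in> torus \<and> real k \<le> norm x \<and> \<sigma> * poly_eval f x < 1 / real (Suc k) * \<mu> x"
    by auto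
  then obtain x :: "nat \<Rightarrow> real ^ 'n" where x: "\<And>k. x k \<in> torus" "\<And>k. real k \<le> norm (x k)"
    "\<And>k. \<sigma> * poly_eval f (x k) < 1 / real (Suc k) * \<mu> (x k)"
    by metis
  \<comment> \<open>For the zero polynomial the violated inequality would read 0 < 0.\<close>
  have neK: "K \<noteq> {}"
    using x(3)[of 0] by (auto simp: \<mu>_def poly_eval_def K_def)
  define y :: "nat \<Rightarrow> real ^ 'n" where "y k = (\<chi> j. - ln \<bar>x k $ j\<bar>)" for k
  \<comment> \<open>Minimality in the exponent means that \<open>A k\<close> is a monomial of
    largest absolute value at \<open>x k\<close>.\<close>
  define A where "A k = arg_min_on (\<lambda>\<alpha>. e \<alpha> \<bullet> y k) K" for k
  have A: "A k \<in> K" "\<beta> \<in> K \<Longrightarrow> e (A k) \<bullet> y k \<le> e \<beta> \<bullet> y k" for k \<beta>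
    unfolding A_def
    using arg_min_if_finite(1)[OF finK neK] arg_min_least[OF finK neK, of \<beta> "\<lambda>\<alpha>. e \<alpha> \<bullet> y k"] by auto
  \<comment> \<open>The l1 norm is at least \<open>norm (x k)\<close>, so some coordinate has at
    least the average size. Its logarithm will supply the negative coordinate of
    \<open>q\<close>.\<close>
  have "\<exists>j. real k \<le> real CARD('n) * \<bar>x k $ j\<bar>" for k
  proof (rule ccontr)
    assume "\<nexists>j. real k \<le> real CARD('n) * \<bar>x k $ j\<bar>"
    then have "(\<Sum>j\<in>UNIV. \<bar>x k $ j\<bar>) < (\<Sum>j\<in>(UNIV :: 'n set). real k / real CARD('n))"
      by (intro sum_strict_mono) (auto simp: field_simps not_le)
    then show False using norm_le_l1_cart[of "x k"] x(2)[of k] by simp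
  qed
  then obtain m where m: "\<And>k. real k \<le> real CARD('n) * \<bar>x k $ m k\<bar>" by metis
  \<comment> \<open>Only finitely many combinations of largest monomial, large coordinate and sign
    pattern occur, so all three can be frozen at once.\<close>
  have "finite (range (\<lambda>k. (A k, m k, {j. x k $ j < 0})))"
    by (rule finite_subset[of _ "K \<times> UNIV \<times> UNIV"]) (use A finK in auto)
  then obtain r1 :: "nat \<Rightarrow> nat" and v where r1: "strict_mono r1" "\<And>k. (A (r1 k), m (r1 k), {j. x (r1 k) $ j < 0}) = v"
    by (rule finite_range_constant_subseq) blast
  obtain \<alpha> i S where v: "v = (\<alpha>, i, S)" by (cases v)
  define d where "d \<beta> = e \<beta> - e \<alpha>" for \<beta>
  have \<alpha>: "\<alpha> \<in> K" using r1(2)[of 0] A(1)[of "r1 0"] v by simp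
  have d_nonneg: "0 \<le> d \<beta> \<bullet> y (r1 k)" if "\<beta> \<in> K" for \<beta> k
    using A(2)[OF that, of "r1 k"] r1(2)[of k] v by (simp add: d_def inner_diff_left)
  obtain r2 :: "nat \<Rightarrow> nat" where r2: "strict_mono r2"
    "\<And>\<beta>. \<beta> \<in> K \<Longrightarrow> bounded (range (\<lambda>k. d \<beta> \<bullet> y (r1 (r2 k)))) \<or>
      filterlim (\<lambda>k. d \<beta> \<bullet> y (r1 (r2 k))) at_top sequentially"
    using nonneg_subseq_bounded_or_at_top[OF finK, of "\<lambda>\<beta> k. d \<beta> \<bullet> y (r1 k)"] d_nonneg by auto
  \<comment> \<open>These are the exponents whose monomials stay comparable to the largest one along
    the subsequence; all others become negligible.\<close>
  define M where "M = {\<beta>\<in>K. bounded (range (\<lambda>k. d \<beta> \<bullet> y (r1 (r2 k))))}"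
  obtain b :: "nat \<Rightarrow> real ^ 'n" where b: "bounded (range b)" "\<And>u k. u \<in> d ` M \<Longrightarrow> u \<bullet> (y (r1 (r2 k)) - b k) = 0"
    using bounded_correction_orthogonal[of "d ` M" "\<lambda>k. y (r1 (r2 k))"] unfolding M_def by blast
  \<comment> \<open>The limit \<open>b'\<close> will provide the logarithmic coordinates of the
    torus point at which the face polynomial is evaluated.\<close>
  obtain b' and r3 :: "nat \<Rightarrow> nat" where r3: "strict_mono r3" "(b \<circ> r3) \<longlonglongrightarrow> b'"
    using b(1) bounded_imp_convergent_subsequence by blast
  define r where "r k = r1 (r2 (r3 k))" for k
  define b3 where "b3 k = b (r3 k)" for k
  have "strict_mono r"
    using strict_mono_compose[OF r1(1) strict_mono_compose[OF r2(1) r3(1)]] unfolding r_def .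
  then have r_lim: "filterlim r at_top sequentially" by (rule filterlim_subseq)
  have b3: "b3 \<longlonglongrightarrow> b'" using r3(2) by (simp add: b3_def[abs_def] o_def)
  have dM: "d \<beta> \<bullet> y (r k) = d \<beta> \<bullet> b3 k" if "\<beta> \<in> M" for \<beta> k
    using b(2)[of "d \<beta>" "r3 k"] that by (simp add: r_def b3_def inner_diff_right)
  have dK: "filterlim (\<lambda>k. d \<beta> \<bullet> y (r k)) at_top sequentially" if "\<beta> \<in> K - M" for \<beta>
    using filterlim_compose[OF _ filterlim_subseq[OF r3(1)]] r2(2)[of \<beta>] that
    unfolding M_def r_def by blast
  define s :: "real ^ 'n" where "s = (\<chi> j. if j \<in> S then - 1 else 1)"
  have x_eq: "x (r k) = (\<chi> j. s $ j * exp (- (y (r k) $ j)))" for k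
  proof -
    have "{j. x (r k) $ j < 0} = S" using r1(2)[of "r2 (r3 k)"] v by (simp add: r_def)
    then show ?thesis
      using x(1)[of "r k"] by (auto simp: vec_eq_iff s_def y_def torus_def)
  qed
  have monom_x: "monom_eval \<beta> (x (r k)) = monom_eval \<beta> s * exp (- (e \<beta> \<bullet> y (r k)))" for \<beta> k
    unfolding x_eq e_def by (rule monom_eval_signed_exp)
  have monom_s: "\<bar>monom_eval \<beta> s\<bar> = 1" for \<beta>
    by (auto simp: monom_eval_def s_def abs_prod power_abs intro!: prod.neutral)
  \<comment> \<open>Multiplying by \<open>exp (e \<alpha> \<bullet> y (r k))\<close> divides by the
    absolute value of the largest monomial.\<close>
  have scale: "monom_eval \<beta> (x (r k)) * exp (e \<alpha> \<bullet> y (r k)) = monom_eval \<beta> s * exp (- (d \<beta> \<bullet> y (r k)))" for \<beta> k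
    unfolding monom_x d_def by (simp add: inner_diff_left mult.assoc flip: exp_add)

  have yi: "filterlim (\<lambda>k. - (y (r k) $ i)) at_top sequentially"
  proof -
    have "m (r k) = i" for k using r1(2)[of "r2 (r3 k)"] v by (simp add: r_def)
    then have *: "real (r k) / real CARD('n) \<le> \<bar>x (r k) $ i\<bar>" for k
      using m[of "r k"] by (simp add: field_simps)
    have "filterlim (\<lambda>k. real (r k) / real CARD('n)) at_top sequentially"
      by (intro filterlim_at_top_mult_tendsto_pos[OF tendsto_const, of "1 / real CARD('n)", simplified]
          filterlim_compose[OF filterlim_real_sequentially r_lim])
    then have "filterlim (\<lambda>k. \<bar>x (r k) $ i\<bar>) at_top sequentially"
      by (rule filterlim_at_top_mono) (use * in auto)
    then have "filterlim (\<lambda>k. ln \<bar>x (r k) $ i\<bar>) at_top sequentially"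
      by (rule filterlim_compose[OF ln_at_top])
    then show ?thesis by (simp add: y_def)
  qed
  \<comment> \<open>The correction makes the products with \<open>d \<beta>\<close> vanish exactly
    for \<beta> in \<open>M\<close>. Being convergent, it disturbs neither the products tending to
    infinity for the other \<beta> nor the \<open>i\<close>-th coordinate tending to minus infinity.
    A single large \<open>k\<close> then gives the required covector.\<close>
  define q where "q k = y (r k) - b3 k" for k
  have "\<forall>\<^sub>F k in sequentially. 0 < d \<beta> \<bullet> q k" if "\<beta> \<in> K - M" for \<beta>
  proof -
    have "filterlim (\<lambda>k. - (d \<beta> \<bullet> b3 k) + d \<beta> \<bullet> y (r k)) at_top sequentially"
      by (rule filterlim_tendsto_add_at_top[OF tendsto_minus[OF tendsto_inner[OF tendsto_const b3]] dK[OF that]])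
    then have "\<forall>\<^sub>F k in sequentially. 0 < - (d \<beta> \<bullet> b3 k) + d \<beta> \<bullet> y (r k)"
      by (rule filterlim_at_top_dense[THEN iffD1, rule_format])
    then show ?thesis by (simp add: q_def inner_diff_right)
  qed
  then have "\<forall>\<^sub>F k in sequentially. \<forall>\<beta>\<in>K - M. 0 < d \<beta> \<bullet> q k"
    using finK by (intro eventually_ball_finite) auto
  moreover have "\<forall>\<^sub>F k in sequentially. q k $ i < 0"
  proof -
    have "filterlim (\<lambda>k. b3 k $ i + - (y (r k) $ i)) at_top sequentially"
      by (rule filterlim_tendsto_add_at_top[OF tendsto_vec_nth[OF b3] yi])
    then have "\<forall>\<^sub>F k in sequentially. 0 < b3 k $ i + - (y (r k) $ i)"
      by (rule filterlim_at_top_dense[THEN iffD1, rule_format])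
    then show ?thesis by (simp add: q_def)
  qed
  ultimately have "\<forall>\<^sub>F k in sequentially. (\<forall>\<beta>\<in>K - M. 0 < d \<beta> \<bullet> q k) \<and> q k $ i < 0"
    by (rule eventually_conj)
  then obtain k where k: "\<And>\<beta>. \<beta> \<in> K - M \<Longrightarrow> 0 < d \<beta> \<bullet> q k" "q k $ i < 0"
    unfolding eventually_sequentially by blast
  have qM: "d \<beta> \<bullet> q k = 0" if "\<beta> \<in> M" for \<beta>
    using dM[OF that] by (simp add: q_def inner_diff_right)
  have dq: "d \<beta> \<bullet> q k = q k \<bullet> exponent_vec \<beta> - q k \<bullet> exponent_vec \<alpha>" for \<beta>
    by (simp only: d_def e_def inner_diff_left inner_commute[of "q k"])
  have q_min: "q k \<bullet> exponent_vec \<alpha> \<le> q k \<bullet> exponent_vec \<beta>" if "\<beta> \<in> K" for \<beta>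
    using k(1)[of \<beta>] qM[of \<beta>] that
    by (cases "\<beta> \<in> M") (auto simp: dq)
  define \<Delta> where "\<Delta> = supp_face (q k) (newton_polyhedron f)"
  have face: "{\<beta> \<in> K. exponent_vec \<beta> \<in> \<Delta>} = M"
  proof -
    have "exponent_vec \<beta> \<in> \<Delta> \<longleftrightarrow> d \<beta> \<bullet> q k = 0" if "\<beta> \<in> K" for \<beta>
      unfolding \<Delta>_def
      using exponent_vec_in_supp_face_iff[of \<alpha> f \<beta> "q k"] \<alpha> that q_min
      by (simp add: K_def dq)
    moreover have "d \<beta> \<bullet> q k = 0 \<longleftrightarrow> \<beta> \<in> M" if "\<beta> \<in> K" for \<beta>
      using k(1)[of \<beta>] qM[of \<beta>] that by (cases "\<beta> \<in> M") auto
    moreover have "M \<subseteq> K" by (auto simp: M_def)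
    ultimately show ?thesis by auto
  qed
  have "Min (range (\<lambda>j. q k $ j)) < 0"
    using k(2) by (subst Min_less_iff) auto
  then have "\<Delta> \<in> newton_boundary_infinity f"
    unfolding newton_boundary_infinity_def \<Delta>_def by blast
  moreover define c where "c = (\<chi> j. s $ j * exp (- (b' $ j)))"
  moreover have "c \<in> torus" by (simp add: c_def s_def torus_def)
  ultimately have "0 < \<sigma> * poly_eval (face_poly f \<Delta>) c"
    using pos by blast
  moreover have "poly_eval (face_poly f \<Delta>) c = (\<Sum>\<beta>\<in>M. a \<beta> * monom_eval \<beta> s * exp (- (e \<beta> \<bullet> b')))"
    unfolding poly_eval_face_poly face[unfolded K_def] c_def monom_eval_signed_exp a_def e_def
    by (simp add: mult.assoc)
  ultimately have face_pos: "0 < \<sigma> * (\<Sum>\<beta>\<in>M. a \<beta> * monom_eval \<beta> s * exp (- (e \<beta> \<bullet> b'))) * exp (e \<alpha> \<bullet> b')"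
    by simp

  \<comment> \<open>On \<open>M\<close> the normalized exponent depends only on the convergent
    correction; off \<open>M\<close> it tends to minus infinity. Only the terms of the face survive
    in the limit.\<close>
  have term_lim: "(\<lambda>k. exp (- (d \<beta> \<bullet> y (r k)))) \<longlonglongrightarrow> (if \<beta> \<in> M then exp (- (d \<beta> \<bullet> b')) else 0)"
    if "\<beta> \<in> K" for \<beta>
  proof (cases "\<beta> \<in> M")
    case True
    then show ?thesis using dM b3 by (auto intro!: tendsto_intros)
  next
    case False
    then have "(\<lambda>k. exp (- (d \<beta> \<bullet> y (r k)))) \<longlonglongrightarrow> 0"
      using dK that by (intro filterlim_compose[OF exp_at_bot] filterlim_compose[OF filterlim_uminus_at_bot_at_top]) auto
    with False show ?thesis by simp
  qed
  have "(\<lambda>k. \<sigma> * poly_eval f (x (r k)) * exp (e \<alpha> \<bullet> y (r k))) \<longlonglongrightarrow>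
    \<sigma> * (\<Sum>\<beta>\<in>K. a \<beta> * monom_eval \<beta> s * (if \<beta> \<in> M then exp (- (d \<beta> \<bullet> b')) else 0))"
  proof -
    have "poly_eval f (x (r k)) * exp (e \<alpha> \<bullet> y (r k)) =
        (\<Sum>\<beta>\<in>K. a \<beta> * monom_eval \<beta> s * exp (- (d \<beta> \<bullet> y (r k))))" for k
      unfolding poly_eval_def sum_distrib_right mult.assoc scale by (simp add: K_def a_def)
    then show ?thesis
      unfolding mult.assoc[of \<sigma>] using term_lim by (auto intro!: tendsto_intros)
  qed
  also have "(\<Sum>\<beta>\<in>K. a \<beta> * monom_eval \<beta> s * (if \<beta> \<in> M then exp (- (d \<beta> \<bullet> b')) else 0)) =
      (\<Sum>\<beta>\<in>M. a \<beta> * monom_eval \<beta> s * exp (- (e \<beta> \<bullet> b'))) * exp (e \<alpha> \<bullet> b')"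
    unfolding sum_distrib_right
    by (rule sum.mono_neutral_cong_right[OF finK])
      (auto simp: M_def d_def inner_diff_left mult.assoc simp flip: exp_add)
  finally have lim: "(\<lambda>k. \<sigma> * poly_eval f (x (r k)) * exp (e \<alpha> \<bullet> y (r k))) \<longlonglongrightarrow>
    \<sigma> * (\<Sum>\<beta>\<in>M. a \<beta> * monom_eval \<beta> s * exp (- (e \<beta> \<bullet> b'))) * exp (e \<alpha> \<bullet> b')"
    by (simp add: mult.assoc)
  \<comment> \<open>After normalization every monomial has absolute value at most 1, hence \<mu> is
    at most \<open>card K\<close>. The violated inequality thus forces a nonpositive limit, against
    \<open>face_pos\<close>.\<close>
  have "\<sigma> * poly_eval f (x (r k)) * exp (e \<alpha> \<bullet> y (r k)) \<le> real (card K) * (1 / real (Suc (r k)))" for k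
  proof -
    have "\<bar>monom_eval \<beta> (x (r k))\<bar> * exp (e \<alpha> \<bullet> y (r k)) \<le> 1" if "\<beta> \<in> K" for \<beta>
    proof -
      have "\<bar>monom_eval \<beta> (x (r k))\<bar> * exp (e \<alpha> \<bullet> y (r k)) = exp (- (d \<beta> \<bullet> y (r k)))"
        using arg_cong[OF scale[of \<beta> k], of abs] monom_s by (simp add: abs_mult)
      then show ?thesis using d_nonneg[OF that, of "r2 (r3 k)"] by (simp add: r_def)
    qed
    then have "\<mu> (x (r k)) * exp (e \<alpha> \<bullet> y (r k)) \<le> (\<Sum>\<beta>\<in>K. 1)"
      unfolding \<mu>_def sum_distrib_right by (rule sum_mono)
    then have \<mu>_le: "\<mu> (x (r k)) * exp (e \<alpha> \<bullet> y (r k)) \<le> real (card K)" by simp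
    have "\<sigma> * poly_eval f (x (r k)) * exp (e \<alpha> \<bullet> y (r k)) \<le>
        1 / real (Suc (r k)) * \<mu> (x (r k)) * exp (e \<alpha> \<bullet> y (r k))"
      by (intro mult_right_mono less_imp_le[OF x(3)]) simp
    also have "\<dots> = 1 / real (Suc (r k)) * (\<mu> (x (r k)) * exp (e \<alpha> \<bullet> y (r k)))"
      by (simp only: mult.assoc)
    also have "\<dots> \<le> 1 / real (Suc (r k)) * real (card K)"
      by (rule mult_left_mono[OF \<mu>_le]) simp
    finally show ?thesis by (simp only: mult.commute)
  qed
  moreover have "(\<lambda>k. real (card K) * (1 / real (Suc (r k)))) \<longlonglongrightarrow> real (card K) * 0"
    by (intro tendsto_intros filterlim_compose[OF LIMSEQ_Suc[OF lim_1_over_n] r_lim])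
  ultimately have "\<sigma> * (\<Sum>\<beta>\<in>M. a \<beta> * monom_eval \<beta> s * exp (- (e \<beta> \<bullet> b'))) * exp (e \<alpha> \<bullet> b') \<le> real (card K) * 0"
    using lim by (intro LIMSEQ_le) auto
  then show False using face_pos by simp
qed

section \<open>Extension from the torus by density\<close>

text \<open>Here \<open>1\<close> is the all-ones vector. Along this direction each coordinate
  vanishes for only one value of \<open>t\<close>.\<close>

lemma eventually_shift_in_torus:
  fixes x :: "real ^ 'n::finite"
  shows "\<forall>\<^sub>F t in at 0. x + t *\<^sub>R 1 \<in> torus"
proof -
  have "\<forall>\<^sub>F t in at 0. x $ j + t \<noteq> 0" for j
    using eventually_neq_at_within[of "- x $ j" 0 UNIV]
    by (rule eventually_mono) auto
  then show ?thesis by (simp add: torus_def eventually_all_finite)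
qed

text \<open>Both sides are continuous, so the bound passes to limits of torus points. The strict
  inequality \<open>R < norm x\<close> persists under small shifts of \<open>x\<close>.\<close>

lemma poly_dominates_monomials:
  fixes f :: "'n::finite real_poly"
  assumes "\<And>\<Delta> x. \<Delta> \<in> newton_boundary_infinity f \<Longrightarrow> x \<in> torus \<Longrightarrow> 0 < \<sigma> * poly_eval (face_poly f \<Delta>) x"
  shows "\<exists>c>0. \<exists>R. \<forall>x. R < norm x \<longrightarrow>
    c * (\<Sum>\<alpha>\<in>Poly_Mapping.keys f. \<bar>monom_eval \<alpha> x\<bar>) \<le> \<sigma> * poly_eval f x"
proof -
  define \<mu> where "\<mu> x = (\<Sum>\<alpha>\<in>Poly_Mapping.keys f. \<bar>monom_eval \<alpha> x\<bar>)" for x :: "real ^ 'n"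
  obtain c R where c: "c > 0" "\<And>x. x \<in> torus \<Longrightarrow> R \<le> norm x \<Longrightarrow> c * \<mu> x \<le> \<sigma> * poly_eval f x"
    using poly_dominates_monomials_on_torus[of f \<sigma>, OF assms] unfolding \<mu>_def by blast
  have "c * \<mu> x \<le> \<sigma> * poly_eval f x" if "R < norm x" for x
  proof -
    define p where "p t = x + t *\<^sub>R 1" for t
    have p: "(p \<longlongrightarrow> x) (at 0)"
      unfolding p_def by (auto intro!: tendsto_eq_intros)
    have cont: "isCont (poly_eval f) x" "isCont (monom_eval \<alpha>) x" for \<alpha>
      using continuous_on_poly_eval[of UNIV f] continuous_on_monom_eval[of UNIV \<alpha>]
      by (auto simp: continuous_on_eq_continuous_at)
    have "((\<lambda>t. \<sigma> * poly_eval f (p t)) \<longlongrightarrow> \<sigma> * poly_eval f x) (at 0)"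
      by (intro tendsto_intros isCont_tendsto_compose[OF cont(1) p])
    moreover have "((\<lambda>t. c * \<mu> (p t)) \<longlongrightarrow> c * \<mu> x) (at 0)"
      unfolding \<mu>_def by (intro tendsto_intros isCont_tendsto_compose[OF cont(2) p])
    moreover have "\<forall>\<^sub>F t in at 0. R < norm (p t)"
      using order_tendstoD(1)[OF tendsto_norm[OF p] that] .
    then have "\<forall>\<^sub>F t in at 0. c * \<mu> (p t) \<le> \<sigma> * poly_eval f (p t)"
      using eventually_shift_in_torus[of x] by eventually_elim (use c(2) in \<open>auto simp: p_def\<close>)
    ultimately show ?thesis by (intro tendsto_le[OF at_neq_bot])
  qed
  then show ?thesis using c(1) unfolding \<mu>_def by blast
qed

section \<open>Compactness of the zero set\<close>

theorem theorem3p2: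
  fixes f :: "'n::finite real_poly"
  assumes "CARD('n) \<ge> 2"
    and "\<not> (\<exists>c. \<forall>x. poly_eval f x = c)"
    and "\<And>J. J \<noteq> {} \<Longrightarrow> \<exists>x\<in>coord_subspace J. poly_eval f x \<noteq> 0"
    and "(\<forall>\<Delta>\<in>newton_boundary_infinity f. \<forall>x\<in>torus. poly_eval (face_poly f \<Delta>) x > 0) \<or>
         (\<forall>\<Delta>\<in>newton_boundary_infinity f. \<forall>x\<in>torus. poly_eval (face_poly f \<Delta>) x < 0)"
  shows "compact (zero_set f)"
proof -
  have "\<exists>\<sigma>::real. \<forall>\<Delta>\<in>newton_boundary_infinity f. \<forall>x\<in>torus. 0 < \<sigma> * poly_eval (face_poly f \<Delta>) x"
    using assms(4)
  proof
    assume "\<forall>\<Delta>\<in>newton_boundary_infinity f. \<forall>x\<in>torus. poly_eval (face_poly f \<Delta>) x > 0"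
    then show ?thesis by (intro exI[of _ 1]) simp
  next
    assume "\<forall>\<Delta>\<in>newton_boundary_infinity f. \<forall>x\<in>torus. poly_eval (face_poly f \<Delta>) x < 0"
    then show ?thesis by (intro exI[of _ "- 1"]) simp
  qed
  then obtain \<sigma> c R where c: "c > 0"
    and bound: "\<And>x. R < norm x \<Longrightarrow> c * (\<Sum>\<alpha>\<in>Poly_Mapping.keys f. \<bar>monom_eval \<alpha> x\<bar>) \<le> \<sigma> * poly_eval f x"
    using poly_dominates_monomials[of f] by metis
  \<comment> \<open>The maximum with 0 ensures that a point violating the bound is nonzero even if
    \<open>R\<close> is negative; its support is then a nonempty index set.\<close>
  have "norm x \<le> max R 0" if "x \<in> zero_set f" for x
  proof (rule ccontr)
    assume "\<not> norm x \<le> max R 0"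
    then have x: "R < norm x" "x \<noteq> 0" by auto
    have "(\<Sum>\<alpha>\<in>Poly_Mapping.keys f. \<bar>monom_eval \<alpha> x\<bar>) \<le> 0"
      using bound[OF x(1)] that c by (simp add: zero_set_def mult_le_0_iff)
    then have "(\<Sum>\<alpha>\<in>Poly_Mapping.keys f. \<bar>monom_eval \<alpha> x\<bar>) = 0"
      by (intro antisym sum_nonneg) auto
    then have vanish: "monom_eval \<alpha> x = 0" if "\<alpha> \<in> Poly_Mapping.keys f" for \<alpha>
      using that by (simp add: sum_nonneg_eq_0_iff)
    have "{j. x $ j \<noteq> 0} \<noteq> {}" using x(2) by (simp add: vec_eq_iff)
    then obtain z where z: "z \<in> coord_subspace {j. x $ j \<noteq> 0}" "poly_eval f z \<noteq> 0"
      using assms(3) by meson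
    \<comment> \<open>A monomial not vanishing at \<open>z\<close> involves only variables from the
      support of \<open>x\<close>, hence does not vanish at \<open>x\<close> either.\<close>
    then obtain \<alpha> where \<alpha>: "\<alpha> \<in> Poly_Mapping.keys f" "monom_eval \<alpha> z \<noteq> 0"
      unfolding poly_eval_def by (metis (no_types, lifting) mult_zero_right sum.neutral)
    then have "monom_eval \<alpha> x \<noteq> 0"
      using z(1) by (auto simp: monom_eval_def coord_subspace_def)
    with vanish \<alpha>(1) show False by blast
  qed
  then have "bounded (zero_set f)" by (auto simp: bounded_iff)
  moreover have "closed (zero_set f)"
    unfolding zero_set_def
    by (intro closed_Collect_eq continuous_on_poly_eval continuous_on_const)
  ultimately show ?thesis by (simp add: compact_eq_bounded_closed)
qed

end
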